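(* Let $U$ be a numeration system such that the numeration language $\mathrm{rep}_U(\mathbb{N})$ is regular. A bi-infinite word $\mathbf{x}=(x_{m,n})_{m,n\ge0}$ over a finite alphabet $B$ is $U$-automatic if and only if its $U$-kernel $\ker_U(\mathbf{x})$ is finite.
   Context: Numeration systems. A (positional) numeration system is an increasing sequence $U=(U_n)_{n\ge 0}$ of integers with $U_0=1$ and $C_U:=\sup_{n\ge 0}\lceil U_{n+1}/U_n\rceil<+\infty$. Put $A_U=\{0,\ldots,C_U-1\}$. The greedy representation of a positive integer $n$ is the word $\mathrm{rep}_U(n)=w_{\ell-1}\cdots w_0$ over $A_U$ with $\sum_{i=0}^{\ell-1}w_iU_i=n$, $w_{\ell-1}\neq 0$ and $\sum_{i=0}^{j-1}w_iU_i<U_j$ for all $j\in\{1,\ldots,\ell\}$; $\mathrm{rep}_U(0)=\varepsilon$ is the empty word. For a word $d_{\ell-1}\cdots d_0$ of integers, $\mathrm{val}_U(d_{\ell-1}\cdots d_0)=\sum_{i=0}^{\ell-1}d_iU_i$. Bi-infinite words and automaticity. A bi-infinite word over $B$ is a two-dimensional array $\mathbf{x}=(x_{m,n})_{m,n\ge0}$ with entries in $B$. It is $U$-automatic if there is a complete deterministic finite automaton with output $(Q,q_0,A_U\times A_U,\delta,\tau)$, with transition function $\delta$ (extended to words over $A_U\times A_U$, identified with pairs of words over $A_U$ of equal length, read from left to right) and output function $\tau\colon Q\to B$, such that $\delta(q_0,(0,0))=q_0$ and, for all $m,n\ge0$, $$x_{m,n}=\tau\bigl(\delta(q_0,(0^{\ell-|\mathrm{rep}_U(m)|}\mathrm{rep}_U(m),\,0^{\ell-|\mathrm{rep}_U(n)|}\mathrm{rep}_U(n)))\bigr),$$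 where $\ell=\max\{|\mathrm{rep}_U(m)|,|\mathrm{rep}_U(n)|\}$. $U$-kernel. For $s\in A_U^*$ let $\mathcal{I}_s=\mathrm{val}_U(0^*\mathrm{rep}_U(\mathbb{N})\cap A_U^*s)=\{i(s,0)<i(s,1)<\cdots\}$, the set of values of the words of $0^*\mathrm{rep}_U(\mathbb{N})$ having $s$ as a suffix, listed in increasing order; this set may be finite or empty. The $U$-kernel of $\mathbf{x}$ is $$\ker_U(\mathbf{x})=\{(x_{i(s,m),i(t,n)})_{m,n\ge0}\mid s,t\in A_U^*,\ |s|=|t|\},$$ where, if $\mathcal{I}_s$ or $\mathcal{I}_t$ is finite or empty, the corresponding array is indexed only by those $(m,n)$ for which $i(s,m)$ and $i(t,n)$ exist (so finite or empty arrays may occur as elements of the kernel). *)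

theory Defs
  imports Complex_Main "HOL-Library.Infinite_Set"
begin

section \<open>Numeration systems\<close>

text \<open>
  An increasing integer sequence with first term 1 is positive, so it is taken in the
  natural numbers. ``Increasing'' means strictly increasing.
\<close>

definition numeration_system :: "(nat \<Rightarrow> nat) \<Rightarrow> bool" where
  "numeration_system U \<longleftrightarrow>
     strict_mono U \<and> U 0 = 1 \<and> bdd_above (range (\<lambda>n. nat \<lceil>real (U (Suc n)) / real (U n)\<rceil>))"

definition digit_bound :: "(nat \<Rightarrow> nat) \<Rightarrow> nat" where
  "digit_bound U = (SUP n. nat \<lceil>real (U (Suc n)) / real (U n)\<rceil>)"

definition digits :: "(nat \<Rightarrow> nat) \<Rightarrow> nat set" where
  "digits U = {..<digit_bound U}"

text \<open>
  Words are lists with the most significant digit first; the digit of weight U i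
  of a word is therefore at position i of the reversed list.
\<close>

definition partial_val :: "(nat \<Rightarrow> nat) \<Rightarrow> nat \<Rightarrow> nat list \<Rightarrow> nat" where
  "partial_val U j w = (\<Sum>i<j. rev w ! i * U i)"

definition val :: "(nat \<Rightarrow> nat) \<Rightarrow> nat list \<Rightarrow> nat" where
  "val U w = partial_val U (length w) w"

definition greedy :: "(nat \<Rightarrow> nat) \<Rightarrow> nat \<Rightarrow> nat list \<Rightarrow> bool" where
  "greedy U n w \<longleftrightarrow>
     w \<in> lists (digits U) \<and> w \<noteq> [] \<and> hd w \<noteq> 0 \<and> val U w = n \<and>
     (\<forall>j\<in>{1..length w}. partial_val U j w < U j)"

definition rep :: "(nat \<Rightarrow> nat) \<Rightarrow> nat \<Rightarrow> nat list" where
  "rep U n = (if n = 0 then [] else (THE w. greedy U n w))"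

lemma partial_val_Cons: "j \<le> length w \<Longrightarrow> partial_val U j (d # w) = partial_val U j w"
  unfolding partial_val_def by (intro sum.cong) (auto simp: nth_append)

lemma val_Cons: "val U (d # w) = d * U (length w) + val U w"
  using partial_val_Cons[of "length w" w U d]
  by (simp add: val_def) (simp add: partial_val_def nth_append)

lemma numeration_system_pos:
  assumes "numeration_system U"
  shows "U l > 0"
proof -
  have "strict_mono U" "U 0 = 1"
    using assms by (simp_all add: numeration_system_def)
  thus ?thesis
    using strict_mono_less_eq[of U 0 l] by simp
qed

lemma greedy_digit:
  assumes "numeration_system U" "n < U (Suc l)"
  shows "n div U l \<in> digits U"
proof -
  let ?f = "\<lambda>n. nat \<lceil>real (U (Suc n)) / real (U n)\<rceil>"
  have pos: "U l > 0" using assms(1) by (rule numeration_system_pos)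
  have f: "?f l \<le> digit_bound U"
    unfolding digit_bound_def using assms(1)
    by (intro cSUP_upper) (auto simp: numeration_system_def)
  have "real (n div U l) < real (U (Suc l)) / real (U l)"
  proof -
    have "n div U l * U l < U (Suc l)"
      using assms(2) by (meson div_times_less_eq_dividend le_less_trans)
    hence "real (n div U l) * real (U l) < real (U (Suc l))"
      by (metis of_nat_less_iff of_nat_mult)
    thus ?thesis using pos by (simp add: field_simps)
  qed
  hence "n div U l < ?f l" by linarith
  from less_le_trans[OF this f] have "n div U l < digit_bound U" .
  thus ?thesis by (simp add: digits_def)
qed

lemma bounded_greedy_ex1:
  assumes U: "numeration_system U" and "n < U l"
  shows "\<exists>!w. length w = l \<and> w \<in> lists (digits U) \<and> val U w = n \<and>
              (\<forall>j\<in>{1..l}. partial_val U j w < U j)"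
  using assms(2)
proof (induction l arbitrary: n)
  case 0
  thus ?case using U by (auto simp: numeration_system_def val_def partial_val_def)
next
  case (Suc l)
  have pos: "U l > 0" using U by (rule numeration_system_pos)
  obtain v where v: "length v = l" "v \<in> lists (digits U)" "val U v = n mod U l"
      "\<forall>j\<in>{1..l}. partial_val U j v < U j"
    using Suc.IH[of "n mod U l"] pos by auto
  let ?w = "n div U l # v"
  have w: "length ?w = Suc l" "?w \<in> lists (digits U)" "val U ?w = n"
    using v(1-3) greedy_digit[OF U Suc.prems] by (simp_all add: val_Cons)
  show ?case
  proof (rule ex1I[of _ ?w], intro conjI ballI)
    fix j assume "j \<in> {1..Suc l}"
    thus "partial_val U j ?w < U j"
      using v w Suc.prems partial_val_Cons[of j v U]
      by (cases "j = Suc l") (auto simp: val_def)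
  next
    fix w' assume w': "length w' = Suc l \<and> w' \<in> lists (digits U) \<and> val U w' = n \<and>
              (\<forall>j\<in>{1..Suc l}. partial_val U j w' < U j)"
    then obtain d u where du: "w' = d # u" "length u = l" by (cases w') auto
    have g: "\<forall>j\<in>{1..l}. partial_val U j u < U j"
    proof
      fix j assume "j \<in> {1..l}"
      thus "partial_val U j u < U j"
        using w' du partial_val_Cons[of j u U d] by force
    qed
    have "val U u < U l"
    proof (cases "l = 0")
      case True thus ?thesis using du pos by (simp add: val_def partial_val_def)
    next
      case False thus ?thesis using g du by (simp add: val_def)
    qed
    moreover have "d * U l + val U u = n" using w' du by (simp add: val_Cons)
    ultimately have d: "d = n div U l" and u: "val U u = n mod U l" by auto
    have "n mod U l < U l" using pos by simp
    from Suc.IH[OF this] have "u = v"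
      by (rule ex1E) (use w' du g v u in \<open>metis Cons_in_lists_iff\<close>)
    with d show "w' = ?w" using du by simp
  qed (use w in auto)
qed

lemma greedy_ex1:
  assumes U: "numeration_system U" and n: "n > 0"
  shows "\<exists>!w. greedy U n w"
proof -
  have mono: "strict_mono U" and U0: "U 0 = 1"
    using U by (auto simp: numeration_system_def)
  have len: "U (length w - 1) \<le> n \<and> n < U (length w)" if "greedy U n w" for w
  proof -
    from that have g: "w \<noteq> []" "hd w \<noteq> 0" "val U w = n"
        "\<forall>j\<in>{1..length w}. partial_val U j w < U j"
      by (simp_all add: greedy_def)
    obtain d v where w: "w = d # v" using g(1) by (cases w) auto
    with g(2) have "U (length v) \<le> d * U (length v)" by simp
    also have "\<dots> \<le> n" using g(3) w by (simp add: val_Cons)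
    finally have "U (length w - 1) \<le> n" using w by simp
    moreover have "length w \<in> {1..length w}" using w by simp
    with g(4) have "partial_val U (length w) w < U (length w)" by blast
    hence "n < U (length w)" using g(3) by (simp add: val_def)
    ultimately show ?thesis by simp
  qed
  define l where "l = (LEAST l. n < U l)"
  have ex: "n < U (Suc n)"
    using strict_mono_imp_increasing[OF mono, of "Suc n"] by simp
  have l: "n < U l" unfolding l_def by (rule LeastI[of "\<lambda>l. n < U l", OF ex])
  have l0: "l \<noteq> 0" using l n U0 by (intro notI) simp
  have l1: "U (l - 1) \<le> n"
    using not_less_Least[of "l - 1" "\<lambda>l. n < U l"] l0 by (simp add: l_def)
  have len_eq: "length w = l" if "greedy U n w" for w
  proof -
    have "length w \<noteq> 0" using that by (auto simp: greedy_def)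
    moreover have "U (length w - 1) < U l" "U (l - 1) < U (length w)"
      using len[OF that] l l1 by linarith+
    hence "length w - 1 < l" "l - 1 < length w"
      by (simp_all only: strict_mono_less[OF mono])
    ultimately show ?thesis using l0 by linarith
  qed
  obtain w where w: "length w = l" "w \<in> lists (digits U)" "val U w = n"
      "\<forall>j\<in>{1..l}. partial_val U j w < U j"
    using bounded_greedy_ex1[OF U l] by blast
  have "hd w \<noteq> 0"
  proof
    assume "hd w = 0"
    then obtain v where v: "w = 0 # v" using w(1) l0 by (cases w) auto
    have "n < U (l - 1)"
    proof (cases "l = 1")
      case True thus ?thesis using v w n by (simp add: val_def partial_val_def)
    next
      case False
      have "val U w = partial_val U (l - 1) w"
        using v w(1) by (auto simp: val_Cons partial_val_Cons) (simp add: val_def)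
      moreover have "l - 1 \<in> {1..l}" using l0 False by simp
      with w(4) have "partial_val U (l - 1) w < U (l - 1)" by blast
      ultimately show ?thesis using w(3) by simp
    qed
    thus False using l1 by simp
  qed
  hence "greedy U n w" using w l0 by (auto simp: greedy_def)
  moreover have "w' = w" if w': "greedy U n w'" for w'
  proof -
    from w' len_eq[OF w'] have "length w' = l" "w' \<in> lists (digits U)" "val U w' = n"
        "\<forall>j\<in>{1..l}. partial_val U j w' < U j"
      by (simp_all add: greedy_def)
    with bounded_greedy_ex1[OF U l] w show ?thesis by metis
  qed
  ultimately show ?thesis by blast
qed

section \<open>Automata and automatic arrays\<close>

record ('q, 'a, 'b) dfao =
  states :: "'q set"
  init :: 'q
  trans :: "'q \<Rightarrow> 'a \<Rightarrow> 'q"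
  out :: "'q \<Rightarrow> 'b"

definition is_dfao :: "'a set \<Rightarrow> 'b set \<Rightarrow> ('q, 'a, 'b) dfao \<Rightarrow> bool" where
  "is_dfao A B M \<longleftrightarrow>
     finite (states M) \<and> init M \<in> states M \<and>
     (\<forall>q\<in>states M. \<forall>a\<in>A. trans M q a \<in> states M) \<and>
     (\<forall>q\<in>states M. out M q \<in> B)"

definition dfao_output :: "('q, 'a, 'b) dfao \<Rightarrow> 'a list \<Rightarrow> 'b" where
  "dfao_output M w = out M (foldl (trans M) (init M) w)"

text \<open>
  Every finite automaton is isomorphic to one whose states are natural numbers, so the two
  existential quantifiers over automata below range over automata with states in type nat.
  A Boolean output marks the final states of an acceptor.
\<close>

definition regular_language :: "'a set \<Rightarrow> 'a list set \<Rightarrow> bool" where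
  "regular_language A L \<longleftrightarrow>
     (\<exists>M :: (nat, 'a, bool) dfao. is_dfao A UNIV M \<and> L = {w \<in> lists A. dfao_output M w})"

definition pad :: "nat \<Rightarrow> nat list \<Rightarrow> nat list" where
  "pad l w = replicate (l - length w) 0 @ w"

text \<open>Pairs of words of equal length become words of pairs through zip.\<close>

definition U_automatic :: "(nat \<Rightarrow> nat) \<Rightarrow> 'b set \<Rightarrow> (nat \<Rightarrow> nat \<Rightarrow> 'b) \<Rightarrow> bool" where
  "U_automatic U B x \<longleftrightarrow>
     (\<exists>M :: (nat, nat \<times> nat, 'b) dfao.
        is_dfao (digits U \<times> digits U) B M \<and>
        trans M (init M) (0, 0) = init M \<and>
        (\<forall>m n. let l = max (length (rep U m)) (length (rep U n)) in
           x m n = dfao_output M (zip (pad l (rep U m)) (pad l (rep U n)))))"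

section \<open>The kernel\<close>

definition padded_language :: "(nat \<Rightarrow> nat) \<Rightarrow> nat list set" where
  "padded_language U = {replicate k 0 @ rep U n | k n. True}"

definition suffix_values :: "(nat \<Rightarrow> nat) \<Rightarrow> nat list \<Rightarrow> nat set" where
  "suffix_values U s = val U ` (padded_language U \<inter> {w @ s | w. w \<in> lists (digits U)})"

text \<open>
  For a finite set S, the library function enumerate lists S increasingly on the indices
  below the cardinality of S and carries no meaning beyond them.
\<close>

definition has_index :: "nat set \<Rightarrow> nat \<Rightarrow> bool" where
  "has_index S n \<longleftrightarrow> infinite S \<or> n < card S"

text \<open>
  A possibly finite or empty array is a partial function on pairs of indices; its domain is
  the set of pairs for which both indices exist.
\<close>

definition kernel_array ::
  "(nat \<Rightarrow> nat) \<Rightarrow> (nat \<Rightarrow> nat \<Rightarrow> 'b) \<Rightarrow> nat list \<Rightarrow> nat list \<Rightarrow> (nat \<times> nat \<rightharpoonup> 'b)" where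
  "kernel_array U x s t = (\<lambda>(m, n).
     if has_index (suffix_values U s) m \<and> has_index (suffix_values U t) n
     then Some (x (enumerate (suffix_values U s) m) (enumerate (suffix_values U t) n))
     else None)"

definition U_kernel :: "(nat \<Rightarrow> nat) \<Rightarrow> (nat \<Rightarrow> nat \<Rightarrow> 'b) \<Rightarrow> (nat \<times> nat \<rightharpoonup> 'b) set" where
  "U_kernel U x =
     {kernel_array U x s t | s t.
        s \<in> lists (digits U) \<and> t \<in> lists (digits U) \<and> length s = length t}"

end

theory Submission
  imports Defs "HOL-Library.FuncSet"
begin

text \<open>
  The padded numeration language L is closed under suffixes, and on words of equal length in L
  the order of values is lexicographic. Hence the increasing enumeration of the values of the
  words us in L depends on s only through the quotient Q(s) of all u with us in L. There are
  finitely many quotients because L is regular. So the kernel is finite iff there are finitely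
  many partial arrays (u, v) \<mapsto> x(val(us), val(vt)), a Myhill--Nerode condition for the reversed
  words; reading from the other side, the columns of the matrix with these arrays as rows
  provide the states of the automaton.
\<close>

section \<open>Admissible words\<close>

text \<open>The greedy condition without the requirement of a nonzero leading digit. These words
  form the language L of the overview (\<open>padded_language_eq\<close>), in a form suited to
  induction on the word.\<close>

definition admissible :: "(nat \<Rightarrow> nat) \<Rightarrow> nat list \<Rightarrow> bool" where
  "admissible U w \<longleftrightarrow> w \<in> lists (digits U) \<and> (\<forall>j\<in>{1..length w}. partial_val U j w < U j)"

lemma admissible_Nil [simp]: "admissible U []"
  by (simp add: admissible_def)

lemma val_Nil [simp]: "val U [] = 0"
  by (simp add: val_def partial_val_def)

text \<open>The partial values of the proper suffixes ignore the leading digit, so only the bound at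
  full length is new. In particular L is closed under suffixes.\<close>

lemma admissible_Cons:
  "admissible U (d # w) \<longleftrightarrow>
     d \<in> digits U \<and> admissible U w \<and> val U (d # w) < U (Suc (length w))"
proof -
  have "{1..length (d # w)} = insert (Suc (length w)) {1..length w}"
    by auto
  then show ?thesis
    by (auto simp: admissible_def partial_val_Cons val_def)
qed

lemma admissible_in_lists: "admissible U w \<Longrightarrow> w \<in> lists (digits U)"
  by (simp add: admissible_def)

lemma val_replicate_0 [simp]: "val U (replicate k 0 @ w) = val U w"
  by (induction k) (auto simp: val_Cons)

lemma admissible_val_less:
  assumes "numeration_system U" "admissible U w"
  shows "val U w < U (length w)"
  using assms by (cases w) (auto simp: admissible_Cons numeration_system_def)

lemma zero_in_digits:
  assumes "numeration_system U"
  shows "0 \<in> digits U"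
  using greedy_digit[OF assms, of 0 0] numeration_system_pos[OF assms] by simp

text \<open>The new bound is automatic here: the value stays below \<open>U (length w)\<close>, and
  \<open>U\<close> increases.\<close>

lemma admissible_Cons_0 [simp]:
  assumes "numeration_system U"
  shows "admissible U (0 # w) \<longleftrightarrow> admissible U w"
proof -
  have "U (length w) < U (Suc (length w))"
    using assms by (simp add: numeration_system_def strict_mono_less)
  then show ?thesis
    using admissible_val_less[OF assms, of w] zero_in_digits[OF assms]
    by (auto simp: admissible_Cons val_Cons)
qed

lemma admissible_replicate_0 [simp]:
  assumes "numeration_system U"
  shows "admissible U (replicate k 0 @ w) \<longleftrightarrow> admissible U w"
  using assms by (induction k) auto

section \<open>Representations as admissible words\<close>

lemma greedy_rep:
  assumes "numeration_system U" "n > 0"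
  shows "greedy U n (rep U n)"
  using theI'[OF greedy_ex1[OF assms]] assms by (simp add: rep_def)

lemma admissible_rep:
  assumes "numeration_system U"
  shows "admissible U (rep U n)"
  using greedy_rep[OF assms, of n]
  by (cases "n = 0") (auto simp: rep_def[of U 0] greedy_def admissible_def)

lemma val_rep:
  assumes "numeration_system U"
  shows "val U (rep U n) = n"
  using greedy_rep[OF assms, of n]
  by (cases "n = 0") (auto simp: rep_def[of U 0] greedy_def)

lemma rep_val:
  assumes "numeration_system U" "admissible U w" "w = [] \<or> hd w \<noteq> 0"
  shows "rep U (val U w) = w"
proof (cases w)
  case Nil
  then show ?thesis by (simp add: rep_def)
next
  case (Cons d v)
  then have "val U w > 0"
    using assms(3) numeration_system_pos[OF assms(1)] by (simp add: val_Cons)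
  moreover from this have "greedy U (val U w) (rep U (val U w))"
    using greedy_rep[OF assms(1)] by blast
  moreover have "greedy U (val U w) w"
    using assms Cons by (auto simp: greedy_def admissible_def)
  ultimately show ?thesis
    using greedy_ex1[OF assms(1)] by blast
qed

lemma strip_zeros:
  fixes w :: "nat list"
  obtains k v where "w = replicate k 0 @ v" "v = [] \<or> hd v \<noteq> 0"
proof (induction w arbitrary: thesis)
  case Nil
  show ?case
    by (rule Nil[of 0 "[]"]) simp_all
next
  case (Cons d w)
  show ?case
  proof (cases "d = 0")
    case True
    obtain k v where "w = replicate k 0 @ v" "v = [] \<or> hd v \<noteq> 0"
      using Cons.IH by blast
    then show ?thesis
      using True by (intro Cons.prems[of "Suc k" v]) simp_all
  next
    case False
    show ?thesis
      by (rule Cons.prems[of 0 "d # w"]) (use False in simp_all)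
  qed
qed

lemma admissible_eq_padded_rep:
  assumes "numeration_system U" "admissible U w"
  obtains k where "w = replicate k 0 @ rep U (val U w)"
proof -
  obtain k v where w: "w = replicate k 0 @ v" "v = [] \<or> hd v \<noteq> 0"
    by (rule strip_zeros)
  have "rep U (val U v) = v"
    using assms w by (intro rep_val) simp_all
  then show ?thesis
    using that w(1) by simp
qed

lemma padded_language_eq:
  assumes "numeration_system U"
  shows "padded_language U = Collect (admissible U)"
proof (intro equalityI subsetI)
  fix w assume "w \<in> padded_language U"
  then show "w \<in> Collect (admissible U)"
    using assms admissible_rep[OF assms] by (auto simp: padded_language_def)
next
  fix w assume "w \<in> Collect (admissible U)"
  then obtain k where "w = replicate k 0 @ rep U (val U w)"
    using admissible_eq_padded_rep[OF assms, of w] by blast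
  then show "w \<in> padded_language U"
    unfolding padded_language_def by blast
qed

section \<open>Quotients and the order on suffix values\<close>

text \<open>The right quotient of L by \<open>s\<close>, written Q(s) in the overview.\<close>

definition quot :: "(nat \<Rightarrow> nat) \<Rightarrow> nat list \<Rightarrow> nat list set" where
  "quot U s = {u. admissible U (u @ s)}"

lemma quot_replicate_0:
  assumes "numeration_system U"
  shows "replicate k 0 @ u \<in> quot U s \<longleftrightarrow> u \<in> quot U s"
  using assms by (simp add: quot_def)

lemma suffix_values_eq:
  assumes "numeration_system U"
  shows "suffix_values U s = (\<lambda>u. val U (u @ s)) ` quot U s"
proof -
  have "Collect (admissible U) \<inter> {w @ s | w. w \<in> lists (digits U)} = (\<lambda>u. u @ s) ` quot U s"
    by (force simp: quot_def dest: admissible_in_lists)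
  then show ?thesis
    by (simp add: suffix_values_def padded_language_eq[OF assms] image_image)
qed

text \<open>On admissible words of equal length the order of the values is the lexicographic order.\<close>

lemma val_append_less_transfer_aux:
  assumes "numeration_system U" "length u = length v"
    and "u \<in> quot U s" "v \<in> quot U s" "u \<in> quot U s'" "v \<in> quot U s'"
    and "val U (u @ s) < val U (v @ s)"
  shows "val U (u @ s') < val U (v @ s')"
  using assms(2-)
proof (induction u v rule: list_induct2)
  case (Cons d u e v)
  have q: "u \<in> quot U s" "v \<in> quot U s" "u \<in> quot U s'" "v \<in> quot U s'"
    using Cons.prems by (simp_all add: quot_def admissible_Cons)
  have mult_less: "a * N + y < b * N + z" if "a < b" "y < N" for a b N y z :: nat
  proof -
    have "a * N + y < Suc a * N" using that by simp
    also have "\<dots> \<le> b * N" using that by (intro mult_le_mono1) simp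
    finally show ?thesis by simp
  qed
  have less: "val U (u @ s') < U (length (u @ s'))" "val U (v @ s) < U (length (v @ s))"
    using q admissible_val_less[OF assms(1)] by (simp_all add: quot_def del: length_append)
  consider "d < e" | "d = e" | "e < d" by linarith
  then show ?case
  proof cases
    case 1
    then show ?thesis
      using mult_less[OF 1 less(1)] Cons.hyps by (simp add: val_Cons)
  next
    case 2
    then show ?thesis
      using Cons.IH[OF q] Cons.prems(5) Cons.hyps by (simp add: val_Cons)
  next
    \<comment> \<open>Contradictory case: the larger leading digit \<open>d\<close> would give
      \<open>(d # u) @ s\<close> the larger value.\<close>
    case 3
    then show ?thesis
      using mult_less[OF 3 less(2), of "val U (u @ s)"] Cons.prems(5) Cons.hyps
      by (simp add: val_Cons)
  qed
qed simp

lemma pad_quot: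
  assumes "numeration_system U" "u \<in> quot U s" "length u \<le> l"
  shows "pad l u \<in> quot U s" "length (pad l u) = l" "val U (pad l u @ s') = val U (u @ s')"
  using assms by (simp_all add: pad_def quot_replicate_0)

text \<open>Leading zeros change neither admissibility nor value, so \<open>u\<close> and
  \<open>v\<close> can first be padded to a common length.\<close>

lemma val_append_less_transfer:
  assumes "numeration_system U" "quot U s = quot U s'" "u \<in> quot U s" "v \<in> quot U s"
    and "val U (u @ s) < val U (v @ s)"
  shows "val U (u @ s') < val U (v @ s')"
proof -
  let ?l = "max (length u) (length v)"
  note pad = pad_quot[OF assms(1), of u s ?l] pad_quot[OF assms(1), of v s ?l]
  have "val U (pad ?l u @ s') < val U (pad ?l v @ s')"
    by (rule val_append_less_transfer_aux[OF assms(1), of _ _ s])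
      (use assms pad in simp_all)
  then show ?thesis
    using assms pad by simp
qed

section \<open>Transport of increasing enumerations\<close>

lemma has_index_image:
  assumes "strict_mono_on S f"
  shows "has_index (f ` S) m \<longleftrightarrow> has_index S m"
  using strict_mono_on_imp_inj_on[OF assms]
  by (simp add: has_index_def card_image finite_image_iff)

text \<open>\<open>enumerate\<close> repeatedly removes the least element, and a strictly increasing
  map commutes with taking and removing it. Through \<open>has_index\<close>, finite and infinite
  sets are handled together.\<close>

lemma enumerate_image:
  fixes f :: "nat \<Rightarrow> nat"
  assumes "strict_mono_on S f" "has_index S m"
  shows "enumerate (f ` S) m = f (enumerate S m)"
  using assms
proof (induction m arbitrary: S)
  have Least_image: "(LEAST y. y \<in> f ` S) = f (LEAST y. y \<in> S)"
    if "strict_mono_on S f" "S \<noteq> {}" for S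
  proof (rule Least_equality)
    have L: "(LEAST y. y \<in> S) \<in> S"
      using that(2) by (meson LeastI ex_in_conv)
    then show "f (LEAST y. y \<in> S) \<in> f ` S"
      by simp
    fix y assume "y \<in> f ` S"
    then show "f (LEAST y. y \<in> S) \<le> y"
      using that(1) L by (auto intro: strict_mono_on_leD Least_le)
  qed
  {
    case 0
    then have "S \<noteq> {}"
      by (auto simp: has_index_def)
    then show ?case
      using Least_image[of S] 0 by (simp add: enumerate_0)
  next
    case (Suc m)
    have ne: "S \<noteq> {}"
      using Suc.prems(2) by (auto simp: has_index_def)
    let ?S = "S - {LEAST y. y \<in> S}"
    have L: "(LEAST y. y \<in> S) \<in> S"
      using ne by (meson LeastI ex_in_conv)
    have "f ` S - {LEAST y. y \<in> f ` S} = f ` ?S"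
      using L strict_mono_on_imp_inj_on[OF Suc.prems(1)] Least_image[OF Suc.prems(1) ne]
      by (auto simp: inj_on_def)
    moreover have "strict_mono_on ?S f"
      using Suc.prems(1) by (simp add: strict_mono_on_def)
    moreover have "has_index ?S m"
      using Suc.prems(2) L by (auto simp: has_index_def card_Diff_singleton)
    ultimately show ?case
      using Suc.IH[of ?S] by (simp add: enumerate_Suc)
  }
qed

lemma enumerate_in: "has_index S m \<Longrightarrow> enumerate S m \<in> S"
  by (auto simp: has_index_def intro: enumerate_in_set finite_enumerate_in_set)

lemma enumerate_surj:
  assumes "y \<in> S"
  obtains m where "has_index S m" "enumerate S m = y"
  using assms enumerate_Ex[of S y] finite_enumerate_Ex[of S y] that
  by (metis has_index_def)

text \<open>The isomorphism replaces the suffix \<open>s\<close> by \<open>s'\<close> behind the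
  same \<open>u\<close>; it is increasing by \<open>val_append_less_transfer\<close>.\<close>

lemma suffix_values_order_iso:
  assumes "numeration_system U" "quot U s = quot U s'"
  obtains f where "strict_mono_on (suffix_values U s) f"
    and "suffix_values U s' = f ` suffix_values U s"
    and "\<And>u. u \<in> quot U s \<Longrightarrow> f (val U (u @ s)) = val U (u @ s')"
proof -
  \<comment> \<open>Words \<open>u\<close> differing in leading zeros give the same value, so one is
    chosen; the next claim shows that the choice is immaterial.\<close>
  define f where "f y = val U ((SOME u. u \<in> quot U s \<and> val U (u @ s) = y) @ s')" for y
  have f: "f (val U (u @ s)) = val U (u @ s')" if "u \<in> quot U s" for u
  proof -
    let ?v = "SOME v. v \<in> quot U s \<and> val U (v @ s) = val U (u @ s)"
    have v: "?v \<in> quot U s \<and> val U (?v @ s) = val U (u @ s)"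
      by (rule someI[of _ u]) (use that in simp)
    \<comment> \<open>A strict inequality with suffix \<open>s'\<close> would transfer back to one
      between the equal values with suffix \<open>s\<close>.\<close>
    have "\<not> val U (?v @ s') < val U (u @ s')" "\<not> val U (u @ s') < val U (?v @ s')"
      using v that assms(2) val_append_less_transfer[OF assms(1) assms(2)[symmetric]]
      by (metis less_irrefl)+
    then show ?thesis
      by (simp add: f_def)
  qed
  show ?thesis
  proof (rule that[OF _ _ f])
    show "strict_mono_on (suffix_values U s) f"
      using val_append_less_transfer[OF assms]
      by (auto simp: suffix_values_eq[OF assms(1)] f intro!: strict_mono_onI)
    show "suffix_values U s' = f ` suffix_values U s"
      using assms(2) by (simp add: suffix_values_eq[OF assms(1)] image_image f cong: image_cong)
  qed
qed

lemma has_index_suffix_values_cong: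
  assumes "numeration_system U" "quot U s = quot U s'"
  shows "has_index (suffix_values U s) m \<longleftrightarrow> has_index (suffix_values U s') m"
  using suffix_values_order_iso[OF assms] has_index_image by metis

text \<open>The order isomorphism preserves positions, so one word \<open>u\<close> accounts for
  position \<open>m\<close> in both sets. This turns indices of kernel arrays into words an
  automaton can read.\<close>

lemma quot_of_index:
  assumes "numeration_system U" "quot U s = quot U s'" "has_index (suffix_values U s) m"
  obtains u where "u \<in> quot U s" "enumerate (suffix_values U s) m = val U (u @ s)"
    "enumerate (suffix_values U s') m = val U (u @ s')"
proof -
  obtain f where f: "strict_mono_on (suffix_values U s) f"
    "suffix_values U s' = f ` suffix_values U s"
    "\<And>u. u \<in> quot U s \<Longrightarrow> f (val U (u @ s)) = val U (u @ s')"
    using suffix_values_order_iso[OF assms(1,2)] by blast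
  obtain u where "u \<in> quot U s" "enumerate (suffix_values U s) m = val U (u @ s)"
    using enumerate_in[OF assms(3)] unfolding suffix_values_eq[OF assms(1)] by blast
  then show ?thesis
    using that f enumerate_image[OF f(1) assms(3)] by simp
qed

text \<open>The translation opposite to \<open>quot_of_index\<close>, from words to indices.\<close>

lemma index_of_quot:
  assumes "numeration_system U" "quot U s = quot U s'" "u \<in> quot U s"
  obtains m where "has_index (suffix_values U s) m"
    "enumerate (suffix_values U s) m = val U (u @ s)"
    "enumerate (suffix_values U s') m = val U (u @ s')"
proof -
  obtain f where f: "strict_mono_on (suffix_values U s) f"
    "suffix_values U s' = f ` suffix_values U s"
    "\<And>u. u \<in> quot U s \<Longrightarrow> f (val U (u @ s)) = val U (u @ s')"
    using suffix_values_order_iso[OF assms(1,2)] by blast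
  have "val U (u @ s) \<in> suffix_values U s"
    using assms(3) by (simp add: suffix_values_eq[OF assms(1)])
  then obtain m where m: "has_index (suffix_values U s) m"
    "enumerate (suffix_values U s) m = val U (u @ s)"
    by (rule enumerate_surj)
  then show ?thesis
    using that[of m] f enumerate_image[OF f(1) m(1)] assms(3) by simp
qed

section \<open>Finiteness principles\<close>

text \<open>On \<open>X\<close> the map \<open>K\<close> factors through \<open>H\<close>, by way of
  a chosen preimage.\<close>

lemma finite_image_factor:
  assumes "finite (H ` X)" "\<And>a b. a \<in> X \<Longrightarrow> b \<in> X \<Longrightarrow> H a = H b \<Longrightarrow> K a = K b"
  shows "finite (K ` X)"
proof -
  have "K ` X \<subseteq> (\<lambda>h. K (SOME a. a \<in> X \<and> H a = h)) ` H ` X"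
  proof
    fix y assume "y \<in> K ` X"
    then obtain a where a: "a \<in> X" "y = K a" by blast
    let ?b = "SOME b. b \<in> X \<and> H b = H a"
    have "?b \<in> X \<and> H ?b = H a"
      by (rule someI[of _ a]) (use a in simp)
    then have "K ?b = y"
      using assms(2)[of ?b a] a by simp
    then show "y \<in> (\<lambda>h. K (SOME a. a \<in> X \<and> H a = h)) ` H ` X"
      using a(1) by blast
  qed
  then show ?thesis
    using assms(1) by (meson finite_imageI finite_subset)
qed

text \<open>A column is determined by its entries in the finitely many distinct rows, hence by a
  function from a finite set into \<open>V\<close>.\<close>

lemma finite_columns:
  assumes "finite (f ` R)" "finite V" "\<And>r c. r \<in> R \<Longrightarrow> c \<in> C \<Longrightarrow> f r c \<in> V"
  shows "finite ((\<lambda>c. \<lambda>r\<in>R. f r c) ` C)"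
proof (rule finite_image_factor)
  show "finite ((\<lambda>c. \<lambda>\<rho>\<in>f ` R. \<rho> c) ` C)"
    by (rule finite_subset[OF _ finite_PiE[OF assms(1), of "\<lambda>_. V"]])
      (use assms in auto)
  fix c c'
  assume eq: "(\<lambda>\<rho>\<in>f ` R. \<rho> c) = (\<lambda>\<rho>\<in>f ` R. \<rho> c')"
  show "(\<lambda>r\<in>R. f r c) = (\<lambda>r\<in>R. f r c')"
  proof (rule restrict_ext)
    fix r assume "r \<in> R"
    then show "f r c = f r c'"
      using fun_cong[OF eq, of "f r"] by simp
  qed
qed

section \<open>Transition maps of automata and finiteness of the quotients\<close>

lemma foldl_in_states:
  assumes "is_dfao A B M" "q \<in> states M" "w \<in> lists A"
  shows "foldl (trans M) q w \<in> states M"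
  using assms(2,3) by (induction w arbitrary: q) (use assms(1) in \<open>auto simp: is_dfao_def\<close>)

text \<open>The element of the transition monoid induced by \<open>w\<close>. Restriction to the
  states leaves only finitely many such maps.\<close>

definition run_map :: "('q, 'a, 'b) dfao \<Rightarrow> 'a list \<Rightarrow> 'q \<Rightarrow> 'q" where
  "run_map M w = (\<lambda>q\<in>states M. foldl (trans M) q w)"

lemma finite_run_maps:
  assumes "is_dfao A B M"
  shows "finite (run_map M ` lists A)"
proof (rule finite_subset)
  show "run_map M ` lists A \<subseteq> states M \<rightarrow>\<^sub>E states M"
    by (rule image_subsetI)
      (simp add: run_map_def foldl_in_states[OF assms] del: in_lists_conv_set)
  show "finite (states M \<rightarrow>\<^sub>E states M)"
    using assms by (intro finite_PiE) (auto simp: is_dfao_def)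
qed

lemma dfao_output_append_cong:
  assumes "is_dfao A B M" "u \<in> lists A" "run_map M s = run_map M s'"
  shows "dfao_output M (u @ s) = dfao_output M (u @ s')"
proof -
  have "foldl (trans M) (init M) u \<in> states M"
    using assms(1,2) by (intro foldl_in_states) (auto simp: is_dfao_def)
  then show ?thesis
    using fun_cong[OF assms(3), of "foldl (trans M) (init M) u"]
    by (simp add: dfao_output_def run_map_def)
qed

text \<open>Automaticity is stated for states in \<open>nat\<close>, whereas the states constructed
  below are functions. An injection of the finite state set carries the automaton over, including
  loops at the initial state.\<close>

lemma dfao_nat_states:
  fixes M :: "('q, 'a, 'b) dfao"
  assumes "is_dfao A B M"
  obtains M' :: "(nat, 'a, 'b) dfao" where "is_dfao A B M'"
    and "\<And>w. w \<in> lists A \<Longrightarrow> dfao_output M' w = dfao_output M w"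
    and "\<And>a. a \<in> A \<Longrightarrow> trans M (init M) a = init M \<Longrightarrow> trans M' (init M') a = init M'"
proof -
  have "finite (states M)"
    using assms by (simp add: is_dfao_def)
  then obtain h :: "'q \<Rightarrow> nat" where h: "inj_on h (states M)"
    using finite_imp_inj_to_nat_seg by blast
  define g where "g = the_inv_into (states M) h"
  have g: "g (h q) = q" if "q \<in> states M" for q
    using the_inv_into_f_f[OF h that] by (simp add: g_def)
  define M' where "M' = \<lparr>states = h ` states M, init = h (init M),
    trans = (\<lambda>n a. h (trans M (g n) a)), out = (\<lambda>n. out M (g n))\<rparr>"
  have init: "init M \<in> states M"
    using assms by (simp add: is_dfao_def)
  have run: "foldl (trans M') (h q) w = h (foldl (trans M) q w)"
    if "q \<in> states M" "w \<in> lists A" for q w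
    using that
    by (induction w arbitrary: q) (use assms in \<open>auto simp: M'_def g is_dfao_def\<close>)
  show ?thesis
  proof
    show "is_dfao A B M'"
      using assms by (auto simp: is_dfao_def M'_def g)
    show "dfao_output M' w = dfao_output M w" if "w \<in> lists A" for w
      using run[OF init that] g[OF foldl_in_states[OF assms init that]]
      by (simp add: dfao_output_def M'_def)
    show "trans M' (init M') a = init M'" if "a \<in> A" "trans M (init M) a = init M" for a
      using that init by (simp add: M'_def g)
  qed
qed

text \<open>Admissibility of \<open>s\<close> and its transition map in \<open>N\<close> determine
  Q(s). Strip the leading zeros of \<open>u\<close>: if a nonempty \<open>v\<close> remains,
  \<open>v @ s\<close> has no leading zero and \<open>N\<close> decides it; otherwise only
  admissibility of \<open>s\<close> counts, which \<open>N\<close> need not detect since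
  \<open>s\<close> may begin with 0.\<close>

lemma finite_quots:
  assumes "numeration_system U" "regular_language (digits U) (range (rep U))"
  shows "finite (quot U ` lists (digits U))"
proof -
  obtain N :: "(nat, nat, bool) dfao" where N: "is_dfao (digits U) UNIV N"
    "range (rep U) = {w \<in> lists (digits U). dfao_output N w}"
    using assms(2) unfolding regular_language_def by blast
  have adm_iff: "admissible U (v @ s) \<longleftrightarrow> v @ s \<in> range (rep U)" if "v \<noteq> []" "hd v \<noteq> 0" for v s
  proof
    assume "admissible U (v @ s)"
    then have "rep U (val U (v @ s)) = v @ s"
      using that by (intro rep_val[OF assms(1)]) simp_all
    then show "v @ s \<in> range (rep U)"
      by (metis rangeI)
  qed (use admissible_rep[OF assms(1)] in auto)
  show ?thesis
  proof (rule finite_image_factor)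
    show "finite ((\<lambda>s. (admissible U s, run_map N s)) ` lists (digits U))"
      by (rule finite_subset[of _ "UNIV \<times> run_map N ` lists (digits U)"])
        (use finite_run_maps[OF N(1)] in auto)
    fix s s' assume s: "s \<in> lists (digits U)" "s' \<in> lists (digits U)"
      and eq: "(admissible U s, run_map N s) = (admissible U s', run_map N s')"
    have "admissible U (u @ s) \<longleftrightarrow> admissible U (u @ s')" for u
    proof -
      obtain k v where u: "u = replicate k 0 @ v" "v = [] \<or> hd v \<noteq> 0"
        by (rule strip_zeros)
      have "admissible U (v @ s) \<longleftrightarrow> admissible U (v @ s')"
      proof (cases "v = []")
        case False
        then show ?thesis
          using u(2) adm_iff s dfao_output_append_cong[OF N(1), of v s s'] eq
          unfolding N(2) by auto
      qed (use eq in simp)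
      then show ?thesis
        using u(1) assms(1) by simp
    qed
    then show "quot U s = quot U s'"
      by (simp add: quot_def)
  qed
qed

section \<open>Automaticity and the kernel\<close>

lemma zip_in_lists:
  "u \<in> lists A \<Longrightarrow> v \<in> lists B \<Longrightarrow> zip u v \<in> lists (A \<times> B)"
  by (fastforce dest: set_zip_leftD set_zip_rightD)

lemma foldl_replicate_fixed:
  "f q a = q \<Longrightarrow> foldl f q (replicate k a) = q"
  by (induction k) auto

text \<open>The loop on \<open>(0, 0)\<close> absorbs common leading zeros, so the output formula
  extends from minimal padding to all pairs of admissible words of equal length.\<close>

lemma dfao_output_admissible:
  assumes "numeration_system U"
    and "trans M (init M) (0, 0) = init M"
    and M: "\<And>m n. let l = max (length (rep U m)) (length (rep U n)) in
           x m n = dfao_output M (zip (pad l (rep U m)) (pad l (rep U n)))"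
    and "admissible U w" "admissible U w'" "length w = length w'"
  shows "x (val U w) (val U w') = dfao_output M (zip w w')"
proof -
  obtain k where k: "w = replicate k 0 @ rep U (val U w)"
    using admissible_eq_padded_rep[OF assms(1,4)] .
  obtain k' where k': "w' = replicate k' 0 @ rep U (val U w')"
    using admissible_eq_padded_rep[OF assms(1,5)] .
  define v v' where "v = rep U (val U w)" and "v' = rep U (val U w')"
  define l where "l = max (length v) (length v')"
  have w: "w = replicate k 0 @ v" "w' = replicate k' 0 @ v'"
    using k k' by (simp_all add: v_def v'_def)
  \<comment> \<open>The number of leading zero pairs in excess of the minimal padding.\<close>
  define j where "j = length w - l"
  have "k = j + (l - length v)" "k' = j + (l - length v')"
    using assms(6) by (auto simp: w l_def j_def)
  then have "w = replicate j 0 @ pad l v" "w' = replicate j 0 @ pad l v'"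
    by (simp_all add: w pad_def replicate_add)
  then have "zip w w' = replicate j (0, 0) @ zip (pad l v) (pad l v')"
    by (metis length_replicate zip_append zip_replicate min.idem)
  then have "dfao_output M (zip w w') = dfao_output M (zip (pad l v) (pad l v'))"
    using foldl_replicate_fixed[of "trans M" "init M" "(0, 0)" j] assms(2)
    by (simp add: dfao_output_def)
  then show ?thesis
    using M[of "val U w" "val U w'"] by (simp add: Let_def v_def v'_def l_def)
qed

definition word_pairs :: "(nat \<Rightarrow> nat) \<Rightarrow> (nat list \<times> nat list) set" where
  "word_pairs U = {(s, t). s \<in> lists (digits U) \<and> t \<in> lists (digits U) \<and> length s = length t}"

text \<open>The two quotients and the transition map of \<open>zip s t\<close> determine the kernel
  array: the quotients fix which indices exist and which words precede the suffixes, the transition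
  map fixes the output. Each of the three takes finitely many values.\<close>

lemma U_automatic_imp_finite_kernel:
  assumes U: "numeration_system U"
    and reg: "regular_language (digits U) (range (rep U))"
    and "U_automatic U B x"
  shows "finite (U_kernel U x)"
proof -
  obtain M :: "(nat, nat \<times> nat, 'a) dfao"
    where M: "is_dfao (digits U \<times> digits U) B M"
      "trans M (init M) (0, 0) = init M"
      "\<And>m n. let l = max (length (rep U m)) (length (rep U n)) in
           x m n = dfao_output M (zip (pad l (rep U m)) (pad l (rep U n)))"
    using assms(3) unfolding U_automatic_def by blast
  let ?D = "lists (digits U)"
  have ker: "U_kernel U x = (\<lambda>(s, t). kernel_array U x s t) ` word_pairs U"
    by (auto simp: U_kernel_def word_pairs_def)
  define H where "H = (\<lambda>(s, t). (quot U s, quot U t, run_map M (zip s t)))"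
  show ?thesis
    unfolding ker
  proof (rule finite_image_factor)
    have "H ` word_pairs U \<subseteq> quot U ` ?D \<times> quot U ` ?D \<times> run_map M ` lists (digits U \<times> digits U)"
      by (rule image_subsetI)
        (simp add: H_def word_pairs_def zip_in_lists split_beta del: in_lists_conv_set)
    then show "finite (H ` word_pairs U)"
      by (rule finite_subset)
        (intro finite_cartesian_product finite_quots[OF U reg] finite_run_maps[OF M(1)])
  next
    fix a b assume ab: "a \<in> word_pairs U" "b \<in> word_pairs U" "H a = H b"
    obtain s t s' t' where st: "a = (s, t)" "b = (s', t')" by fastforce
    have len: "length s = length t" "length s' = length t'"
      and qs: "quot U s = quot U s'" and qt: "quot U t = quot U t'"
      and run: "run_map M (zip s t) = run_map M (zip s' t')"
      using ab by (auto simp: st H_def word_pairs_def)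
    have "x (enumerate (suffix_values U s) m) (enumerate (suffix_values U t) n) =
          x (enumerate (suffix_values U s') m) (enumerate (suffix_values U t') n)"
      if m: "has_index (suffix_values U s) m" and n: "has_index (suffix_values U t) n" for m n
    proof -
      obtain u0 where u0: "u0 \<in> quot U s" "enumerate (suffix_values U s) m = val U (u0 @ s)"
        "enumerate (suffix_values U s') m = val U (u0 @ s')"
        using quot_of_index[OF U qs m] .
      obtain v0 where v0: "v0 \<in> quot U t" "enumerate (suffix_values U t) n = val U (v0 @ t)"
        "enumerate (suffix_values U t') n = val U (v0 @ t')"
        using quot_of_index[OF U qt n] .
      \<comment> \<open>The prefixes found for \<open>m\<close> and \<open>n\<close> may differ in
        length; padding lets them be read as one word of pairs.\<close>
      define l where "l = max (length u0) (length v0)"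
      define u v where "u = pad l u0" and "v = pad l v0"
      have u: "u \<in> quot U s" "length u = l" "\<And>r. val U (u @ r) = val U (u0 @ r)"
        unfolding u_def using pad_quot[OF U u0(1), of l] by (simp_all add: l_def)
      have v: "v \<in> quot U t" "length v = l" "\<And>r. val U (v @ r) = val U (v0 @ r)"
        unfolding v_def using pad_quot[OF U v0(1), of l] by (simp_all add: l_def)
      have out: "x (val U (u @ r)) (val U (v @ r')) = dfao_output M (zip u v @ zip r r')"
        if "u \<in> quot U r" "v \<in> quot U r'" "length r = length r'" for r r'
        using dfao_output_admissible[OF U M(2,3), of "u @ r" "v @ r'"] that u(2) v(2)
        by (simp add: quot_def)
      have "zip u v \<in> lists (digits U \<times> digits U)"
        using u(1) v(1) by (intro zip_in_lists) (auto simp: quot_def dest!: admissible_in_lists)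
      then have "dfao_output M (zip u v @ zip s t) = dfao_output M (zip u v @ zip s' t')"
        by (rule dfao_output_append_cong[OF M(1) _ run])
      then show ?thesis
        using out[of s t] out[of s' t'] u v u0 v0 qs qt len by simp
    qed
    then show "(case a of (s, t) \<Rightarrow> kernel_array U x s t) = (case b of (s, t) \<Rightarrow> kernel_array U x s t)"
      using has_index_suffix_values_cong[OF U qs] has_index_suffix_values_cong[OF U qt]
      by (auto simp: st kernel_array_def fun_eq_iff)
  qed
qed

section \<open>From a finite kernel to an automaton\<close>

text \<open>
  Columns of this matrix, indexed by the words read so far, are the states of the automaton;
  rows, indexed by the words still to be read, correspond to kernel elements.
\<close>

definition entry ::
  "(nat \<Rightarrow> nat) \<Rightarrow> (nat \<Rightarrow> nat \<Rightarrow> 'b) \<Rightarrow> nat list \<times> nat list \<Rightarrow> nat list \<times> nat list \<Rightarrow> 'b option" where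
  "entry U x = (\<lambda>(s, t) (u, v).
     if admissible U (u @ s) \<and> admissible U (v @ t)
     then Some (x (val U (u @ s)) (val U (v @ t))) else None)"

text \<open>A row is determined by the two quotients and the kernel array: the quotients tell where
  the row is defined and at which index pair of the array each defined entry stands.\<close>

lemma finite_entry_rows:
  assumes U: "numeration_system U"
    and reg: "regular_language (digits U) (range (rep U))"
    and ker: "finite (U_kernel U x)"
  shows "finite (entry U x ` word_pairs U)"
proof (rule finite_image_factor)
  let ?D = "lists (digits U)"
  let ?H = "\<lambda>(s, t). (quot U s, quot U t, kernel_array U x s t)"
  have "?H ` word_pairs U \<subseteq> quot U ` ?D \<times> quot U ` ?D \<times> U_kernel U x"
    by (auto simp: word_pairs_def U_kernel_def)
  then show "finite (?H ` word_pairs U)"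
    by (rule finite_subset) (intro finite_cartesian_product finite_quots[OF U reg] ker)
  fix a b assume ab: "?H a = ?H b"
  obtain s t s' t' where st: "a = (s, t)" "b = (s', t')" by fastforce
  have qs: "quot U s = quot U s'" and qt: "quot U t = quot U t'"
    and K: "kernel_array U x s t = kernel_array U x s' t'"
    using ab by (auto simp: st)
  have "x (val U (u @ s)) (val U (v @ t)) = x (val U (u @ s')) (val U (v @ t'))"
    if u: "u \<in> quot U s" and v: "v \<in> quot U t" for u v
  proof -
    obtain m where m: "has_index (suffix_values U s) m"
      "enumerate (suffix_values U s) m = val U (u @ s)"
      "enumerate (suffix_values U s') m = val U (u @ s')"
      using index_of_quot[OF U qs u] .
    obtain n where n: "has_index (suffix_values U t) n"
      "enumerate (suffix_values U t) n = val U (v @ t)"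
      "enumerate (suffix_values U t') n = val U (v @ t')"
      using index_of_quot[OF U qt v] .
    show ?thesis
      using fun_cong[OF K, of "(m, n)"] m n
        has_index_suffix_values_cong[OF U qs, of m] has_index_suffix_values_cong[OF U qt, of n]
      by (simp add: kernel_array_def)
  qed
  moreover have "admissible U (u @ s) \<longleftrightarrow> admissible U (u @ s')"
    "admissible U (u @ t) \<longleftrightarrow> admissible U (u @ t')" for u
    using qs qt by (auto simp: quot_def)
  ultimately show "entry U x a = entry U x b"
    by (auto simp: entry_def st quot_def fun_eq_iff)
qed

text \<open>Myhill-Nerode construction: the state reached after reading \<open>(u, v)\<close> is its
  column, which records the result of every continuation \<open>(s, t)\<close>.\<close>

lemma finite_kernel_imp_U_automatic:
  assumes U: "numeration_system U"
    and reg: "regular_language (digits U) (range (rep U))"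
    and B: "finite B" "\<And>m n. x m n \<in> B"
    and ker: "finite (U_kernel U x)"
  shows "U_automatic U B x"
proof -
  let ?D = "digits U" and ?W = "word_pairs U"
  define col where "col c = (\<lambda>r\<in>?W. entry U x r c)" for c
  \<comment> \<open>Finiteness of \<open>B\<close> makes the set of possible entries finite, as
    \<open>finite_columns\<close> requires.\<close>
  have fin: "finite (col ` ?W)"
    unfolding col_def
    by (rule finite_columns[OF finite_entry_rows[OF U reg ker], of "insert None (Some ` B)"])
      (use B in \<open>auto simp: entry_def\<close>)
  \<comment> \<open>Reading \<open>(a, b)\<close> prepends it to the continuation; the output is the
    entry at the empty continuation. The default \<open>x 0 0\<close> only keeps the output in
    \<open>B\<close> at states where that entry is \<open>None\<close>, which no pair of admissible
    words reaches.\<close>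
  define M :: "(nat list \<times> nat list \<Rightarrow> 'a option, nat \<times> nat, 'a) dfao" where
    "M = \<lparr>states = col ` ?W, init = col ([], []),
      trans = (\<lambda>g (a, b). \<lambda>(s, t)\<in>?W. g (a # s, b # t)),
      out = (\<lambda>g. case g ([], []) of None \<Rightarrow> x 0 0 | Some y \<Rightarrow> y)\<rparr>"
  have Nil: "([], []) \<in> ?W"
    by (simp add: word_pairs_def)
  \<comment> \<open>As \<open>a\<close> and \<open>b\<close> are digits,
    \<open>(a # s, b # t)\<close> stays in the index set of the columns, so the old column has a
    genuine entry there.\<close>
  have step: "trans M (col (u, v)) (a, b) = col (u @ [a], v @ [b])"
    if "a \<in> ?D" "b \<in> ?D" for u v a b
    using that
    by (auto simp: M_def col_def restrict_def entry_def word_pairs_def fun_eq_iff)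
  have M: "is_dfao (?D \<times> ?D) B M"
    unfolding is_dfao_def
  proof (intro conjI ballI)
    show "finite (states M)" "init M \<in> states M"
      using fin Nil by (simp_all add: M_def)
    fix g assume "g \<in> states M"
    then obtain u v where g: "g = col (u, v)" "(u, v) \<in> ?W"
      by (auto simp: M_def)
    show "trans M g ab \<in> states M" if ab_in: "ab \<in> ?D \<times> ?D" for ab
    proof -
      obtain a b where ab: "ab = (a, b)" "a \<in> ?D" "b \<in> ?D"
        using ab_in by blast
      have "(u @ [a], v @ [b]) \<in> ?W"
        using g(2) ab by (simp add: word_pairs_def)
      then show ?thesis
        unfolding g(1) ab(1) step[OF ab(2,3)] by (simp add: M_def)
    qed
    show "out M g \<in> B"
      using B(2) Nil by (simp add: M_def g(1) col_def entry_def)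
  qed
  have run: "foldl (trans M) (col (u, v)) (zip w w') = col (u @ w, v @ w')"
    if "length w = length w'" "w \<in> lists ?D" "w' \<in> lists ?D" for u v w w'
    using that
    by (induction w w' arbitrary: u v rule: list_induct2) (simp_all add: step)
  have read: "dfao_output M (zip w w') = x (val U w) (val U w')"
    if "length w = length w'" "admissible U w" "admissible U w'" for w w'
    using run[OF that(1), of "[]" "[]"] that Nil admissible_in_lists
    by (simp add: dfao_output_def M_def col_def entry_def)
  \<comment> \<open>Prefixing a zero to both words leaves admissibility and values alone, so the
    columns of \<open>([0], [0])\<close> and \<open>([], [])\<close> agree.\<close>
  have loop: "trans M (init M) (0, 0) = init M"
    using U zero_in_digits[OF U]
    by (auto simp: M_def col_def restrict_def entry_def word_pairs_def fun_eq_iff val_Cons)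
  obtain M' :: "(nat, nat \<times> nat, 'a) dfao" where M': "is_dfao (?D \<times> ?D) B M'"
    "\<And>w. w \<in> lists (?D \<times> ?D) \<Longrightarrow> dfao_output M' w = dfao_output M w"
    "\<And>a. a \<in> ?D \<times> ?D \<Longrightarrow> trans M (init M) a = init M \<Longrightarrow> trans M' (init M') a = init M'"
    using dfao_nat_states[OF M] by blast
  show ?thesis
    unfolding U_automatic_def
  proof (intro exI[of _ M'] conjI allI)
    show "trans M' (init M') (0, 0) = init M'"
      using M'(3)[of "(0, 0)"] loop zero_in_digits[OF U] by simp
    fix m n
    define l where "l = max (length (rep U m)) (length (rep U n))"
    have adm: "admissible U (pad l (rep U m))" "admissible U (pad l (rep U n))"
      using U admissible_rep[OF U] by (simp_all add: pad_def)
    have "length (pad l (rep U m)) = length (pad l (rep U n))"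
      by (simp add: pad_def l_def)
    then have "dfao_output M (zip (pad l (rep U m)) (pad l (rep U n))) = x m n"
      using read[OF _ adm] by (simp add: pad_def val_rep[OF U])
    moreover have "zip (pad l (rep U m)) (pad l (rep U n)) \<in> lists (?D \<times> ?D)"
      using adm admissible_in_lists by (intro zip_in_lists) blast+
    ultimately show "let l = max (length (rep U m)) (length (rep U n)) in
        x m n = dfao_output M' (zip (pad l (rep U m)) (pad l (rep U n)))"
      using M'(2) by (simp add: Let_def flip: l_def)
  qed (rule M'(1))
qed

theorem proposition5p3:
  fixes U :: "nat \<Rightarrow> nat" and B :: "'b set" and x :: "nat \<Rightarrow> nat \<Rightarrow> 'b"
  assumes "numeration_system U"
    and "regular_language (digits U) (range (rep U))"
    and "finite B"
    and "\<forall>m n. x m n \<in> B"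
  shows "U_automatic U B x \<longleftrightarrow> finite (U_kernel U x)"
  using assms U_automatic_imp_finite_kernel finite_kernel_imp_U_automatic by blast

end
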